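(* Let $n\ge2$ be an integer, let $S\subset\{0,\dots,n-1\}$ with $|S|<n/2$, and let $$\mathfrak{S}=\{1\}\cup\{m\in\mathbb{Z}_{>0}: m=qn+r,\ r\in S,\ q\in\mathbb{Z}\}.$$ Start the discrete fragmentation process with stopping set $\mathfrak{S}$ from $R$ identical sticks of positive integer length $L\notin\mathfrak{S}$. Then for every base $B>1$, as $R\to\infty$ and $L\to\infty$, the collection of base-$B$ mantissas of ending stick lengths does not converge to any continuous distribution on $[0,1]$. In particular, the collection of ending stick lengths does not converge to strong Benford behavior base $B$.
   Context: For $B>1$ and $x>0$ the mantissa is $M_B(x)=\log_B x-\lfloor\log_B x\rfloor\in[0,1)$, and the significand is $S_B(x)=B^{M_B(x)}\in[1,B)$. Discrete fragmentation process with stopping set $\mathfrak{S}\subseteq\mathbb{Z}_{>0}$, started from $R$ sticks of integer length $L\notin\mathfrak{S}$: all starting sticks are alive. At each level, every living stick, of length $\ell$ say, is broken into two sticks of lengths $X$ and $\ell-X$, where $X$ is uniformly distributed on $\{1,\dots,\ell-1\}$, independently for different sticks. A new stick becomes dead (is never broken again) if its length is in $\mathfrak{S}$, and is alive otherwise. The process ends when all sticks are dead; the ending sticks are all the dead sticks. Convergence: let $(L_j,R_j)$ be a sequence with $L_j\notin\mathfrak{S}$, $L_j\to\infty$, $R_j\to\infty$, and let $Q_j(t)$ be the proportion of ending sticks (counted with multiplicity), for the process with parameters $L_j,R_j$, whose length has mantissa at most $t$. The mantissas converge to a distribution with continuous cumulative distribution function $F$ on $[0,1]$ if $\mathbb{E}[Q_j(t)]\to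 F(t)$ and $\operatorname{Var}[Q_j(t)]\to0$ for all $t\in[0,1]$; convergence to strong Benford behavior is the case $F(t)=t$. The theorem asserts that along no such sequence does this happen for any continuous $F$. *)

theory Defs
  imports "HOL-Probability.Probability"
begin

definition log_mantissa :: "real \<Rightarrow> real \<Rightarrow> real" where
  "log_mantissa B x = log B x - of_int \<lfloor>log B x\<rfloor>"

text \<open>
  A configuration of sticks is the list of their (positive) integer lengths. With respect to a
  stopping set \<open>D\<close>, a stick is dead if its length lies in \<open>D\<close>, and alive otherwise.
\<close>

definition break_stick :: "nat set \<Rightarrow> nat \<Rightarrow> nat list pmf" where
  "break_stick D l =
     (if l \<in> D then return_pmf [l]
      else map_pmf (\<lambda>x. [x, l - x]) (pmf_of_set {1..l - 1}))"

text \<open>The nested binds make the breaks of different sticks of one level independent.\<close>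

primrec break_level :: "nat set \<Rightarrow> nat list \<Rightarrow> nat list pmf" where
  "break_level D [] = return_pmf []"
| "break_level D (l # ls) =
     bind_pmf (break_stick D l) (\<lambda>xs.
     bind_pmf (break_level D ls) (\<lambda>ys. return_pmf (xs @ ys)))"

primrec after_levels :: "nat set \<Rightarrow> nat \<Rightarrow> nat list \<Rightarrow> nat list pmf" where
  "after_levels D 0 ls = return_pmf ls"
| "after_levels D (Suc k) ls = bind_pmf (after_levels D k ls) (break_level D)"

text \<open>
  Every break shortens a living stick by at least one. Hence, if \<open>1 \<in> D\<close> (so that every living
  stick can be broken), the process started from sticks of length \<open>l\<close> has ended after at most \<open>l\<close>
  levels, and its configuration does not change any more; see \<open>after_levels_dead\<close> and
  \<open>after_levels_stable\<close> below. So the configuration after \<open>l\<close> levels is the list of ending sticks.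
\<close>

definition ending_sticks :: "nat set \<Rightarrow> nat \<Rightarrow> nat \<Rightarrow> nat list pmf" where
  "ending_sticks D l r = after_levels D l (replicate r l)"

lemma break_level_dead:
  assumes "set ls \<subseteq> D"
  shows "break_level D ls = return_pmf ls"
  using assms by (induction ls) (auto simp: break_stick_def bind_return_pmf)

lemma break_stick_support:
  assumes "1 \<in> D" "0 < l" "l \<in> D \<or> l + k \<le> m"
    and "xs \<in> set_pmf (break_stick D l)" "x \<in> set xs"
  shows "0 < x \<and> (x \<in> D \<or> x + Suc k \<le> m)"
proof (cases "l \<in> D")
  case True
  then show ?thesis using assms by (auto simp: break_stick_def)
next
  case False
  with assms(1,2) have "l \<noteq> 1" "l \<noteq> 0" by auto
  then have "{1..l - 1} \<noteq> {}" by auto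
  then show ?thesis using False assms by (auto simp: break_stick_def set_pmf_of_set)
qed

lemma break_level_support:
  assumes "1 \<in> D" "\<forall>l\<in>set ls. 0 < l \<and> (l \<in> D \<or> l + k \<le> m)"
    and "xs \<in> set_pmf (break_level D ls)"
  shows "\<forall>x\<in>set xs. 0 < x \<and> (x \<in> D \<or> x + Suc k \<le> m)"
  using assms(2,3)
proof (induction ls arbitrary: xs)
  case (Cons l ls)
  then obtain ys zs where "ys \<in> set_pmf (break_stick D l)"
    "zs \<in> set_pmf (break_level D ls)" "xs = ys @ zs"
    by auto
  moreover have "\<forall>x\<in>set ys. 0 < x \<and> (x \<in> D \<or> x + Suc k \<le> m)"
    using Cons.prems(1) calculation(1) break_stick_support[OF assms(1), of l k m ys] by simp
  moreover have "\<forall>x\<in>set zs. 0 < x \<and> (x \<in> D \<or> x + Suc k \<le> m)"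
    using Cons.prems(1) calculation(2) by (intro Cons.IH) simp_all
  ultimately show ?case by auto
qed simp

lemma after_levels_support:
  assumes "1 \<in> D" "0 < l" "xs \<in> set_pmf (after_levels D k (replicate r l))"
  shows "\<forall>x\<in>set xs. 0 < x \<and> (x \<in> D \<or> x + k \<le> l)"
  using assms(3)
proof (induction k arbitrary: xs)
  case (Suc k)
  then obtain ys where ys: "ys \<in> set_pmf (after_levels D k (replicate r l))"
    and xs: "xs \<in> set_pmf (break_level D ys)"
    by auto
  show ?case using break_level_support[OF assms(1) Suc.IH[OF ys] xs] .
qed (use assms in auto)

lemma after_levels_dead:
  assumes "1 \<in> D" "0 < l" "l \<le> k" "xs \<in> set_pmf (after_levels D k (replicate r l))"
  shows "set xs \<subseteq> D"
proof
  fix x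
  assume "x \<in> set xs"
  with after_levels_support[OF assms(1,2,4)] have "0 < x" "x \<in> D \<or> x + k \<le> l" by auto
  with assms(3) show "x \<in> D" by linarith
qed

lemma after_levels_stable:
  assumes "1 \<in> D" "0 < l" "l \<le> k"
  shows "after_levels D k (replicate r l) = ending_sticks D l r"
  using assms(3)
proof (induction k rule: dec_induct)
  case base
  show ?case by (simp add: ending_sticks_def)
next
  case (step k)
  have "after_levels D (Suc k) (replicate r l) =
    bind_pmf (after_levels D k (replicate r l)) return_pmf"
    unfolding after_levels.simps
    by (intro bind_pmf_cong refl break_level_dead)
      (rule after_levels_dead[OF assms(1,2) step.hyps(1)])
  then show ?case using step.IH by (simp add: bind_return_pmf')
qed

definition mantissa_proportion :: "real \<Rightarrow> real \<Rightarrow> nat list \<Rightarrow> real" where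
  "mantissa_proportion B t xs =
     real (length (filter (\<lambda>x. log_mantissa B (real x) \<le> t) xs)) / real (length xs)"

definition mantissas_converge ::
  "real \<Rightarrow> nat set \<Rightarrow> (nat \<Rightarrow> nat) \<Rightarrow> (nat \<Rightarrow> nat) \<Rightarrow> (real \<Rightarrow> real) \<Rightarrow> bool" where
  "mantissas_converge B D L R F \<longleftrightarrow>
     (\<forall>t\<in>{0..1}.
        (\<lambda>j. measure_pmf.expectation (ending_sticks D (L j) (R j)) (mantissa_proportion B t))
          \<longlonglongrightarrow> F t \<and>
        (\<lambda>j. measure_pmf.variance (ending_sticks D (L j) (R j)) (mantissa_proportion B t))
          \<longlonglongrightarrow> 0)"

definition converges_to_strong_benford ::
  "real \<Rightarrow> nat set \<Rightarrow> (nat \<Rightarrow> nat) \<Rightarrow> (nat \<Rightarrow> nat) \<Rightarrow> bool" where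
  "converges_to_strong_benford B D L R \<longleftrightarrow> mantissas_converge B D L R (\<lambda>t. t)"

text \<open>
  A continuous distribution on \<open>[0,1]\<close> is a probability measure on the reals which is concentrated
  on \<open>[0,1]\<close> and whose distribution function is continuous on the whole real line. In particular
  it has no atom at \<open>0\<close>. Continuity of the distribution function on \<open>[0,1]\<close> alone would admit the
  point mass at \<open>0\<close>, to which the mantissas do converge for the stopping set \<open>{1}\<close>.
\<close>

definition continuous_distribution_on_unit :: "real measure \<Rightarrow> bool" where
  "continuous_distribution_on_unit \<mu> \<longleftrightarrow>
     real_distribution \<mu> \<and> measure \<mu> {0..1} = 1 \<and> continuous_on UNIV (cdf \<mu>)"

definition stopping_set :: "nat \<Rightarrow> nat set \<Rightarrow> nat set" where
  "stopping_set n S =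
     {1} \<union> {m. 0 < m \<and> (\<exists>q::int. \<exists>r\<in>S. int m = q * int n + int r)}"

end

theory Submission
  imports Defs
begin

text \<open>
  The proof shows that a fixed positive proportion of the ending sticks has length \<open>1\<close>, on average and
  uniformly in the starting length \<open>l\<close> and in the number \<open>r\<close> of starting sticks. The mantissa of \<open>1\<close> is
  \<open>0\<close>, so every limit \<open>F\<close> has \<open>F 0 > 0\<close>. A continuous distribution on \<open>[0,1]\<close> and the Benford
  distribution both have \<open>F 0 = 0\<close>.

  For the positive proportion, consider one stick of length \<open>l\<close> and let \<open>g l\<close> be the expected value of
  a quantity that is additive over the ending sticks. Conditioning on the first break gives
  \<open>g l = 2 / (l - 1) * (\<Sum>x<l. g x)\<close> for living \<open>l\<close>. So the partial sums of \<open>g\<close> are multiplied by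
  \<open>(l + 1) / (l - 1)\<close> at each living length, and dead lengths only add their own values. The product
  of these factors over the living lengths is \<open>growth\<close>, and the mean number of ending sticks of length
  \<open>1\<close> is at least \<open>2 * growth l / l\<close> for living \<open>l\<close> (\<open>mean_ones_ge\<close>). A dead length \<open>m\<close> contributes about
  \<open>growth l / (l * growth m)\<close> to the mean number of all ending sticks. If a proportion \<open>\<beta>\<close> of the
  residue classes is alive, then \<open>growth m\<close> is of order \<open>m\<close> to the power \<open>2 * \<beta>\<close>. This is where
  \<open>\<beta> > 1 / 2\<close> enters: the series of the \<open>1 / growth m\<close> converges (\<open>sum_inverse_growth_le\<close>), so the
  short sticks dominate and the two means are of the same order (\<open>mean_count_le\<close>).

  Comparing means is not enough for the expectation of a quotient. The number \<open>N\<close> of all ending sticks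
  and the number \<open>N1\<close> of those of length \<open>1\<close> satisfy \<open>(E N1)\<^sup>2 \<le> E (N1 / N) * E (N\<^sup>2)\<close>, so it remains to
  bound \<open>E (N\<^sup>2)\<close> by a multiple of \<open>(E N1)\<^sup>2\<close>. The second moment for one stick solves the same recursion with
  a source term, a sum of products of means, and \<open>\<beta> > 1 / 2\<close> again makes the contributions of these
  sources summable in the required sense (\<open>sum_rel_growth_div_le\<close>, \<open>second_moment_le\<close>).
\<close>

lemma split_sum_le:
  fixes f :: "nat \<Rightarrow> real"
  assumes "0 < t" "\<And>m. 0 < m \<Longrightarrow> 0 \<le> f m"
  shows "sum f {1..<l} \<le> sum f {1..<min l t} + sum f {t..<l}"
proof -
  have "sum f {1..<l} \<le> sum f ({1..<min l t} \<union> {t..<l})"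
    using assms by (intro sum_mono2) auto
  also have "\<dots> = sum f {1..<min l t} + sum f {t..<l}"
    by (intro sum.union_disjoint) auto
  finally show ?thesis .
qed

lemma sum_reflect: "(\<Sum>x\<in>{1..<l}. g (l - x)) = (\<Sum>x\<in>{1..<l}. g x :: real)" for l :: nat
  by (rule sum.reindex_bij_witness[of _ "\<lambda>x. l - x" "\<lambda>x. l - x"]) auto


section \<open>Growth of the homogeneous solution\<close>

text \<open>
  Thinness says that every window of \<open>n\<close> consecutive lengths contains more living than dead ones, which
  is how a density of living lengths above \<open>1 / 2\<close> enters the estimates. Windows start at \<open>2\<close>
  because \<open>1\<close> is dead whatever its residue.
\<close>

locale thin_stopping_set =
  fixes D :: "nat set" and n :: nat
  assumes one_in: "1 \<in> D"
    and thin: "\<And>l. 2 \<le> l \<Longrightarrow> 2 * card (D \<inter> {l..<l + n}) < n"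
begin

text \<open>
  If \<open>g l = 2 / (l - 1) * (\<Sum>x\<in>{1..<l}. g x)\<close> at living \<open>l\<close> and \<open>g l = 0\<close> at dead \<open>l > 1\<close>, then this product
  is the factor by which the sum of \<open>g\<close> over the lengths below \<open>l > 1\<close> exceeds \<open>g 1\<close>.
\<close>

definition growth :: "nat \<Rightarrow> real" where
  "growth l = (\<Prod>k\<in>{1..<l}. if k \<in> D then 1 else (real k + 1) / (real k - 1))"

text \<open>The order of magnitude of the mean number of ending sticks from one living stick of length \<open>l\<close>.\<close>

definition rel_growth :: "nat \<Rightarrow> real" where
  "rel_growth l = growth l / real l"

lemma window_pos: "0 < n"
  using thin[of 2] by simp

lemma alive_ge_2: "l \<notin> D \<Longrightarrow> 0 < l \<Longrightarrow> 2 \<le> l"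
  using one_in by (cases "l = 1") auto

lemma growth_1: "growth (Suc 0) = 1"
  by (simp add: growth_def)

lemma growth_Suc:
  assumes "0 < l"
  shows "growth (Suc l) = growth l * (if l \<in> D then 1 else (real l + 1) / (real l - 1))"
  using assms by (simp add: growth_def prod.atLeastLessThan_Suc)

lemma growth_step: "0 < l \<Longrightarrow> 0 < growth l \<Longrightarrow> growth l \<le> growth (Suc l)"
  using alive_ge_2[of l] by (auto simp: growth_Suc field_simps)

lemma growth_ge_1: "0 < l \<Longrightarrow> 1 \<le> growth l"
proof (induction l rule: nat_induct_non_zero)
  case 1
  then show ?case by (simp add: growth_1)
next
  case (Suc l)
  then show ?case using growth_step[of l] by simp
qed

lemma rel_growth_pos: "0 < l \<Longrightarrow> 0 < rel_growth l"
  using growth_ge_1[of l] by (simp add: rel_growth_def)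

lemma rel_growth_1: "rel_growth (Suc 0) = 1"
  by (simp add: rel_growth_def growth_1)

lemma rel_growth_Suc:
  assumes "0 < l"
  shows "rel_growth (Suc l) =
    rel_growth l * (if l \<in> D then real l / (real l + 1) else real l / (real l - 1))"
proof -
  have "real l \<noteq> 0" "real l + 1 \<noteq> 0" using assms by auto
  then show ?thesis by (simp add: rel_growth_def growth_Suc[OF assms] add.commute)
qed

lemma rel_growth_add_le: "0 < l \<Longrightarrow> rel_growth (l + i) \<le> 2 ^ i * rel_growth l"
proof (induction i)
  case (Suc i)
  define k where "k = l + i"
  have "0 < k" using Suc.prems by (simp add: k_def)
  then have "rel_growth (Suc k) \<le> rel_growth k * 2"
    using alive_ge_2[of k] rel_growth_pos[of k]
    by (auto simp: rel_growth_Suc field_simps)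
  with Suc show ?case by (simp add: k_def)
qed simp

lemma rel_growth_le_add: "0 < l \<Longrightarrow> rel_growth l \<le> 2 ^ i * rel_growth (l + i)"
proof (induction i)
  case (Suc i)
  define k where "k = l + i"
  have "0 < k" using Suc.prems by (simp add: k_def)
  then have "rel_growth k \<le> 2 * rel_growth (Suc k)"
    using alive_ge_2[of k] rel_growth_pos[of k]
    by (auto simp: rel_growth_Suc field_simps)
  then have "2 ^ i * rel_growth k \<le> 2 ^ Suc i * rel_growth (Suc k)" by simp
  with Suc show ?case unfolding k_def add_Suc_right by linarith
qed simp

lemma rel_growth_add:
  assumes "0 < l"
  shows "rel_growth (l + i) =
    rel_growth l * (\<Prod>k\<in>{l..<l + i}. if k \<in> D then real k / (real k + 1) else real k / (real k - 1))"
  using assms by (induction i) (simp_all add: rel_growth_Suc prod.atLeastLessThan_Suc)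

text \<open>
  To first order a living length \<open>k\<close> changes \<open>rel_growth\<close> by the factor \<open>1 + 1 / k\<close> and a dead one by
  \<open>1 - 1 / k\<close>. Each dead length of the window is paired with a living one, which leaves an error of
  order \<open>1 / l\<^sup>2\<close> per pair, and at least one living length is left over. Its gain of about \<open>1 / l\<close>
  beats the errors once \<open>l\<close> is large compared with \<open>n\<^sup>2\<close>.
\<close>

lemma rel_growth_window:
  assumes l: "8 * n * (n + 1) \<le> l"
  shows "rel_growth l * (1 + 1 / (2 * real l)) \<le> rel_growth (l + n)"
proof -
  let ?I = "{l..<l + n}"
  define b where "b = card (D \<inter> ?I)"
  define \<alpha> \<beta> where "\<alpha> = 1 - 1 / real l" and "\<beta> = 1 + 1 / (real l + real n)"
  have n: "1 \<le> n" using window_pos by simp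
  have "8 * (n + 1) \<le> 8 * n * (n + 1)" using n by simp
  then have l8: "8 * (n + 1) \<le> l" using l by linarith
  have l2: "2 \<le> l" and lr: "16 \<le> real l" "8 * real n + 8 \<le> real l"
    using l8 n by simp_all
  have b: "2 * b < n" using thin[OF l2] by (simp add: b_def)
  have \<alpha>0: "0 \<le> \<alpha>" and \<beta>1: "1 \<le> \<beta>" using lr by (auto simp: \<alpha>_def \<beta>_def)
  have "card (?I - D) = n - b"
    by (simp add: b_def card_Diff_subset_Int Int_commute)
  then have a: "b + 1 \<le> card (?I - D)" using b by simp
  have "(\<Prod>k\<in>?I. if k \<in> D then \<alpha> else \<beta>) = \<alpha> ^ b * \<beta> ^ card (?I - D)"
    by (simp add: prod.If_cases b_def Diff_eq Int_commute)
  also have "\<dots> \<ge> \<alpha> ^ b * \<beta> ^ (b + 1)"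
    using a \<alpha>0 \<beta>1 by (intro mult_left_mono power_increasing) auto
  also have "\<alpha> ^ b * \<beta> ^ (b + 1) = (\<alpha> * \<beta>) ^ b * \<beta>"
    by (simp add: power_mult_distrib)
  also have "(\<alpha> * \<beta>) ^ b * \<beta> \<ge> (1 - 1 / (8 * real l)) * (1 + 3 / (4 * real l))"
  proof (rule mult_mono)
    have eq: "\<alpha> * \<beta> = 1 + - ((real n + 1) / (real l * (real l + real n)))"
    proof -
      have "real l \<noteq> 0" "real l + real n \<noteq> 0" using lr by auto
      then show ?thesis unfolding \<alpha>_def \<beta>_def by (simp add: divide_simps) (simp add: algebra_simps)
    qed
    have le: "(real n + 1) / (real l * (real l + real n)) \<le> (real n + 1) / (real l * real l)"
      using lr by (intro divide_left_mono) auto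
    also have "\<dots> \<le> 1"
      using lr mult_mono[of "real n + 1" "real l" 1 "real l"] by (simp add: divide_le_eq)
    finally have "1 + real b * - ((real n + 1) / (real l * (real l + real n))) \<le> (\<alpha> * \<beta>) ^ b"
      unfolding eq by (intro Bernoulli_inequality) auto
    moreover have "real b * ((real n + 1) / (real l * (real l + real n)))
        \<le> real n * ((real n + 1) / (real l * real l))"
      using b le by (intro mult_mono) auto
    moreover have "real n * ((real n + 1) / (real l * real l)) \<le> 1 / (8 * real l)"
    proof -
      have "real (8 * n * (n + 1)) \<le> real l" using l by (simp only: of_nat_le_iff)
      then have "8 * (real n * (real n + 1)) \<le> real l" by (simp add: algebra_simps)
      then have "8 * (real n * (real n + 1)) * real l \<le> real l * real l"
        using lr by (intro mult_right_mono) auto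
      then show ?thesis using lr by (simp add: field_simps)
    qed
    ultimately show "1 - 1 / (8 * real l) \<le> (\<alpha> * \<beta>) ^ b" by simp
    show "1 + 3 / (4 * real l) \<le> \<beta>" using lr by (simp add: \<beta>_def field_simps)
  qed (use \<alpha>0 \<beta>1 lr in \<open>auto simp: field_simps\<close>)
  also have "(1 - 1 / (8 * real l)) * (1 + 3 / (4 * real l)) \<ge> 1 + 1 / (2 * real l)"
    using lr by (simp add: field_simps)
  finally have "1 + 1 / (2 * real l) \<le> (\<Prod>k\<in>?I. if k \<in> D then \<alpha> else \<beta>)" by simp
  also have "\<dots> \<le> (\<Prod>k\<in>?I. if k \<in> D then real k / (real k + 1) else real k / (real k - 1))"
    using \<alpha>0 \<beta>1 lr by (intro prod_mono) (auto simp: \<alpha>_def \<beta>_def field_simps)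
  finally show ?thesis
    unfolding rel_growth_add[OF order.strict_trans2[OF pos2 l2]]
    using rel_growth_pos[of l] l2 by (intro mult_left_mono) auto
qed

text \<open>
  Going from \<open>l\<close> to \<open>l + 1\<close>, the sum over a window changes by \<open>rel_growth (l + n) - rel_growth l\<close>. So the
  growth of \<open>rel_growth\<close> along steps of length \<open>n\<close> becomes growth along single steps, which telescopes.
  Up to constant factors the sum is \<open>rel_growth\<close> itself.
\<close>

definition window_growth :: "nat \<Rightarrow> real" where
  "window_growth l = (\<Sum>i<n. rel_growth (l + i))"

lemma window_growth_Suc:
  "window_growth (Suc l) = window_growth l + (rel_growth (l + n) - rel_growth l)"
proof -
  have "(\<Sum>i<n. rel_growth (l + Suc i)) - (\<Sum>i<n. rel_growth (l + i)) =
      rel_growth (l + n) - rel_growth (l + 0)"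
    unfolding sum_subtractf[symmetric] by (rule sum_lessThan_telescope)
  then show ?thesis by (simp add: window_growth_def)
qed

lemma rel_growth_le_window_growth:
  assumes "0 < l"
  shows "rel_growth l \<le> window_growth l"
  using member_le_sum[of 0 "{..<n}" "\<lambda>i. rel_growth (l + i)"] window_pos
    less_imp_le[OF rel_growth_pos] assms
  by (simp add: window_growth_def)

lemma window_growth_le:
  assumes "0 < l"
  shows "window_growth l \<le> real n * 2 ^ n * rel_growth l"
proof -
  have "rel_growth (l + i) \<le> 2 ^ n * rel_growth l" if "i < n" for i
  proof -
    have "rel_growth (l + i) \<le> 2 ^ i * rel_growth l" using rel_growth_add_le[OF assms] .
    also have "\<dots> \<le> 2 ^ n * rel_growth l"
      using that rel_growth_pos[OF assms] by (intro mult_right_mono power_increasing) auto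
    finally show ?thesis .
  qed
  then have "window_growth l \<le> (\<Sum>i<n. 2 ^ n * rel_growth l)"
    unfolding window_growth_def by (intro sum_mono) auto
  then show ?thesis by simp
qed

definition threshold :: nat where
  "threshold = 8 * n * (n + 1)"

lemma threshold_pos: "0 < threshold"
  using window_pos by (simp add: threshold_def)

lemma window_growth_step:
  assumes "threshold \<le> l"
  shows "rel_growth l / real l \<le> 2 * (window_growth (Suc l) - window_growth l)"
  using rel_growth_window[of l] assms threshold_pos
  by (simp add: window_growth_Suc threshold_def field_simps)

lemma window_growth_mono:
  assumes "threshold \<le> m" "m \<le> l"
  shows "window_growth m \<le> window_growth l"
  using assms(2)
proof (induction rule: dec_induct)
  case (step k)
  have "0 < k" using step assms threshold_pos by simp
  then have "0 \<le> rel_growth k / real k" using rel_growth_pos[of k] by simp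
  with window_growth_step[of k] step assms show ?case by simp
qed simp

text \<open>
  Beyond the threshold this is the monotonicity of \<open>window_growth\<close>. Below it, boundedly many steps
  remain, each of which costs a factor of at most \<open>2\<close>.
\<close>

lemma rel_growth_quasi_mono:
  obtains C where "0 < C" "\<And>m l. 0 < m \<Longrightarrow> m \<le> l \<Longrightarrow> rel_growth m \<le> C * rel_growth l"
proof
  let ?t = threshold
  let ?K = "real n * 2 ^ n"
  let ?C = "2 ^ ?t * ?K"
  have K1: "1 \<le> ?K"
    using window_pos mult_mono[of 1 "real n" 1 "2 ^ n"] by simp
  then show "0 < ?C" by simp
  have C: "1 * ?K \<le> ?C" "2 ^ ?t * 1 \<le> ?C"
    using K1 by (intro mult_right_mono mult_left_mono; simp)+
  fix m l :: nat
  assume m: "0 < m" "m \<le> l"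
  then have q: "0 < rel_growth l" using rel_growth_pos[of l] by simp
  have initial: "rel_growth m \<le> 2 ^ ?t * rel_growth k" if "m \<le> k" "k \<le> ?t" for k
  proof -
    have "rel_growth m \<le> 2 ^ (k - m) * rel_growth k"
      using rel_growth_le_add[OF m(1), of "k - m"] that by simp
    also have "\<dots> \<le> 2 ^ ?t * rel_growth k"
      using that m rel_growth_pos[of k] by (intro mult_right_mono power_increasing) auto
    finally show ?thesis .
  qed
  have late: "rel_growth k \<le> ?K * rel_growth l" if "?t \<le> k" "k \<le> l" for k
  proof -
    have "rel_growth k \<le> window_growth k"
      using that threshold_pos by (intro rel_growth_le_window_growth) auto
    also have "\<dots> \<le> window_growth l" using that by (rule window_growth_mono)
    also have "\<dots> \<le> ?K * rel_growth l" using m by (intro window_growth_le) auto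
    finally show ?thesis .
  qed
  consider "l \<le> ?t" | "?t \<le> m" | "m \<le> ?t" "?t \<le> l" by linarith
  then show "rel_growth m \<le> ?C * rel_growth l"
  proof cases
    case 1
    then show ?thesis using initial[of l] m mult_right_mono[OF C(2), of "rel_growth l"] q by linarith
  next
    case 2
    then show ?thesis using late[of m] m mult_right_mono[OF C(1), of "rel_growth l"] q by linarith
  next
    case 3
    have "rel_growth m \<le> 2 ^ ?t * rel_growth ?t" using 3 by (intro initial) auto
    also have "\<dots> \<le> 2 ^ ?t * (?K * rel_growth l)" using 3 by (intro mult_left_mono late) auto
    finally show ?thesis by (simp add: mult.assoc)
  qed
qed

text \<open>
  The discrete form of \<open>\<integral> x powr (\<theta> - 1) \<le> C * l powr \<theta>\<close> for \<open>\<theta> > 0\<close>: beyond the threshold the summands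
  are dominated by the increments of \<open>window_growth\<close>.
\<close>

lemma sum_rel_growth_div_le:
  obtains C where "0 < C"
    "\<And>l. 0 < l \<Longrightarrow> (\<Sum>m\<in>{1..<l}. rel_growth m / real m) \<le> C * rel_growth l"
proof -
  let ?t = threshold
  obtain C where C: "0 < C"
    "\<And>m l. 0 < m \<Longrightarrow> m \<le> l \<Longrightarrow> rel_growth m \<le> C * rel_growth l"
    using rel_growth_quasi_mono by blast
  show thesis
  proof
    show "0 < real ?t * C + 2 * (real n * 2 ^ n)"
      using C(1) threshold_pos by (intro add_pos_nonneg) auto
    fix l :: nat
    assume l: "0 < l"
    have "(\<Sum>m\<in>{1..<l}. rel_growth m / real m) \<le>
        (\<Sum>m\<in>{1..<min l ?t}. rel_growth m / real m) + (\<Sum>m\<in>{?t..<l}. rel_growth m / real m)"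
      using rel_growth_pos by (intro split_sum_le threshold_pos) (simp add: less_imp_le)
    also have "(\<Sum>m\<in>{1..<min l ?t}. rel_growth m / real m) \<le>
        real (card {1..<min l ?t}) * (C * rel_growth l)"
    proof (rule sum_bounded_above)
      fix m
      assume m: "m \<in> {1..<min l ?t}"
      then have "rel_growth m / real m \<le> rel_growth m / 1"
        using rel_growth_pos[of m] by (intro divide_left_mono) auto
      also have "\<dots> \<le> C * rel_growth l" using C(2)[of m l] m by simp
      finally show "rel_growth m / real m \<le> C * rel_growth l" .
    qed
    also have "\<dots> \<le> real ?t * (C * rel_growth l)"
      using C(1) rel_growth_pos[OF l] by (intro mult_right_mono) auto
    also have "(\<Sum>m\<in>{?t..<l}. rel_growth m / real m) \<le> 2 * (real n * 2 ^ n * rel_growth l)"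
    proof (cases "?t \<le> l")
      case True
      have "(\<Sum>m\<in>{?t..<l}. rel_growth m / real m)
          \<le> (\<Sum>m\<in>{?t..<l}. 2 * (window_growth (Suc m) - window_growth m))"
        by (intro sum_mono window_growth_step) auto
      also have "\<dots> = 2 * (window_growth l - window_growth ?t)"
        using True sum_Suc_diff'[of ?t l "\<lambda>m. 2 * window_growth m"]
        by (simp add: right_diff_distrib)
      also have "\<dots> \<le> 2 * window_growth l"
        using rel_growth_le_window_growth[OF threshold_pos] rel_growth_pos[OF threshold_pos] by simp
      also have "\<dots> \<le> 2 * (real n * 2 ^ n * rel_growth l)"
        using window_growth_le[OF l] by simp
      finally show ?thesis .
    next
      case False
      then show ?thesis using rel_growth_pos[OF l] by simp
    qed
    finally show "(\<Sum>m\<in>{1..<l}. rel_growth m / real m) \<le>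
        (real ?t * C + 2 * (real n * 2 ^ n)) * rel_growth l"
      by (simp add: algebra_simps)
  qed
qed

text \<open>
  The same telescoping, now for the reciprocals: \<open>1 / growth m\<close> is dominated by the decrease of
  \<open>1 / window_growth\<close> from \<open>m\<close> to \<open>m + 1\<close>.
\<close>

lemma sum_inverse_growth_le:
  obtains C where "0 < C" "\<And>l. (\<Sum>m\<in>{1..<l}. 1 / growth m) \<le> C"
proof -
  let ?t = threshold
  define K where "K = real n * 2 ^ n"
  define W where "W = window_growth"
  have K: "0 < K" using window_pos by (simp add: K_def)
  have W: "0 < W m" if "0 < m" for m
    using rel_growth_le_window_growth[OF that] rel_growth_pos[OF that] by (simp add: W_def)
  have step: "1 / growth m \<le> 4 * K\<^sup>2 * (1 / W m - 1 / W (Suc m))" if "?t \<le> m" for m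
  proof -
    have m: "0 < m" using that threshold_pos by simp
    define q where "q = rel_growth m"
    have q: "0 < q" using rel_growth_pos[OF m] by (simp add: q_def)
    have "W (Suc m) \<le> K * rel_growth (Suc m)"
      using window_growth_le[of "Suc m"] by (simp add: W_def K_def)
    also have "\<dots> \<le> K * (2 * q)"
      using K rel_growth_add_le[OF m, of 1] by (intro mult_left_mono) (auto simp: q_def)
    finally have "W m * W (Suc m) \<le> (K * q) * (K * (2 * q))"
      using window_growth_le[OF m] W[OF m] W[of "Suc m"] K q
      by (intro mult_mono) (auto simp: W_def K_def q_def)
    then have prod: "W m * W (Suc m) \<le> 2 * K\<^sup>2 * q\<^sup>2" by (simp add: power2_eq_square mult_ac)
    have "q / real m \<le> 2 * (W (Suc m) - W m)"
      using window_growth_step[OF that] by (simp add: W_def q_def)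
    then have diff: "q / (2 * real m) \<le> W (Suc m) - W m" by simp
    have "(q / (2 * real m)) / (2 * K\<^sup>2 * q\<^sup>2) \<le> (W (Suc m) - W m) / (W m * W (Suc m))"
      using prod diff q W[OF m] W[of "Suc m"] m order_trans[OF _ diff, of 0]
      by (intro frac_le) auto
    also have "\<dots> = 1 / W m - 1 / W (Suc m)"
      using W[OF m] W[of "Suc m"] by (simp add: field_simps)
    finally have "4 * K\<^sup>2 * ((q / (2 * real m)) / (2 * K\<^sup>2 * q\<^sup>2))
        \<le> 4 * K\<^sup>2 * (1 / W m - 1 / W (Suc m))"
      by (intro mult_left_mono) auto
    moreover have "4 * K\<^sup>2 * ((q / (2 * real m)) / (2 * K\<^sup>2 * q\<^sup>2)) = 1 / (real m * q)"
      using K q m by (simp add: field_simps power2_eq_square)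
    moreover have "growth m = real m * q" using m by (simp add: q_def rel_growth_def)
    ultimately show ?thesis by simp
  qed
  show thesis
  proof
    show "0 < real ?t + 4 * K\<^sup>2 / W ?t"
      using threshold_pos W[OF threshold_pos] K by (intro add_pos_nonneg) auto
    fix l :: nat
    have "(\<Sum>m\<in>{1..<l}. 1 / growth m) \<le>
        (\<Sum>m\<in>{1..<min l ?t}. 1 / growth m) + (\<Sum>m\<in>{?t..<l}. 1 / growth m)"
      by (intro split_sum_le threshold_pos) (auto intro: order_trans[OF zero_le_one growth_ge_1])
    also have "(\<Sum>m\<in>{1..<min l ?t}. 1 / growth m) \<le> real (card {1..<min l ?t}) * 1"
      using growth_ge_1 by (intro sum_bounded_above) (auto simp: divide_le_eq_1 intro: less_le_trans)
    also have "\<dots> \<le> real ?t" by simp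
    also have "(\<Sum>m\<in>{?t..<l}. 1 / growth m) \<le> 4 * K\<^sup>2 / W ?t"
    proof (cases "?t \<le> l")
      case True
      have "(\<Sum>m\<in>{?t..<l}. 1 / growth m)
          \<le> (\<Sum>m\<in>{?t..<l}. 4 * K\<^sup>2 * (1 / W m - 1 / W (Suc m)))"
        by (intro sum_mono step) auto
      also have "\<dots> = 4 * K\<^sup>2 * - (\<Sum>m\<in>{?t..<l}. 1 / W (Suc m) - 1 / W m)"
        by (simp add: sum_distrib_left[symmetric] sum_negf[symmetric])
      also have "(\<Sum>m\<in>{?t..<l}. 1 / W (Suc m) - 1 / W m) = 1 / W l - 1 / W ?t"
        using True by (rule sum_Suc_diff')
      also have "4 * K\<^sup>2 * - (1 / W l - 1 / W ?t) \<le> 4 * K\<^sup>2 * (1 / W ?t)"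
        using True threshold_pos W[of l] by (intro mult_left_mono) auto
      finally show ?thesis by simp
    next
      case False
      then show ?thesis using W[OF threshold_pos] by simp
    qed
    finally show "(\<Sum>m\<in>{1..<l}. 1 / growth m) \<le> real ?t + 4 * K\<^sup>2 / W ?t"
      by simp
  qed
qed


section \<open>The fragmentation recursion\<close>

text \<open>
  The expected value of the sum of \<open>c\<close> over all sticks, living or dead, that ever occur in the process
  started from one stick of length \<open>l\<close>. The definition is the solution of the recursion
  \<open>fragment_sum_alive\<close> by variation of constants. With it the bounds below become bounds of
  explicit sums.
\<close>

definition fragment_sum :: "(nat \<Rightarrow> real) \<Rightarrow> nat \<Rightarrow> real" where
  "fragment_sum c l = c l +
     (if l \<in> D then 0
      else 2 / (real l - 1) * (growth l * (\<Sum>m\<in>{1..<l}. c m / growth (Suc m))))"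

text \<open>
  Both sides satisfy the same first-order recursion in \<open>l\<close>. At a living \<open>l\<close> the factor
  \<open>1 + 2 / (l - 1)\<close> of the left-hand side is the factor \<open>(l + 1) / (l - 1)\<close> of \<open>growth\<close>.
\<close>

lemma sum_fragment_sum:
  assumes "0 < l"
  shows "(\<Sum>x\<in>{1..<l}. fragment_sum c x) = growth l * (\<Sum>m\<in>{1..<l}. c m / growth (Suc m))"
  using assms
proof (induction l rule: nat_induct_non_zero)
  case (Suc l)
  define A where "A = (\<Sum>m\<in>{1..<l}. c m / growth (Suc m))"
  have "0 < growth (Suc l)" using growth_ge_1[of "Suc l"] by simp
  then have "growth (Suc l) * (\<Sum>m\<in>{1..<Suc l}. c m / growth (Suc m))
      = growth (Suc l) * A + c l"
    using Suc.hyps by (simp add: sum.atLeastLessThan_Suc A_def field_simps)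
  also have "growth (Suc l) * A + c l = growth l * A + fragment_sum c l"
  proof (cases "l \<in> D")
    case False
    then have "real l - 1 \<noteq> 0" using Suc.hyps alive_ge_2[of l] by auto
    then have "(real l + 1) / (real l - 1) = 1 + 2 / (real l - 1)" by (simp add: field_simps)
    then have "growth (Suc l) = growth l * (1 + 2 / (real l - 1))"
      using growth_Suc[OF Suc.hyps] False by simp
    then show ?thesis
      using False unfolding fragment_sum_def A_def[symmetric] by (simp add: algebra_simps)
  qed (use growth_Suc[OF Suc.hyps] in \<open>simp add: fragment_sum_def\<close>)
  finally show ?case using Suc by (simp add: sum.atLeastLessThan_Suc A_def)
qed simp

lemma fragment_sum_dead: "l \<in> D \<Longrightarrow> fragment_sum c l = c l"
  by (simp add: fragment_sum_def)

lemma fragment_sum_alive: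
  assumes "0 < l" "l \<notin> D"
  shows "fragment_sum c l = c l + 2 / (real l - 1) * (\<Sum>x\<in>{1..<l}. fragment_sum c x)"
  using assms by (simp only: sum_fragment_sum) (simp add: fragment_sum_def)

lemma fragment_sum_nonneg:
  assumes "\<And>m. 0 < m \<Longrightarrow> 0 \<le> c m" "0 < l"
  shows "0 \<le> fragment_sum c l"
proof -
  have growth: "0 \<le> growth m" if "0 < m" for m
    using growth_ge_1[OF that] by simp
  have "0 \<le> (\<Sum>m\<in>{1..<l}. c m / growth (Suc m))"
    using assms(1) growth by (intro sum_nonneg divide_nonneg_nonneg) auto
  moreover have "0 \<le> 2 / (real l - 1)" using assms(2) by simp
  ultimately show ?thesis
    using assms growth[OF assms(2)] unfolding fragment_sum_def
    by (auto intro!: add_nonneg_nonneg mult_nonneg_nonneg)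
qed

lemma fragment_sum_le:
  assumes c: "\<And>m. 0 < m \<Longrightarrow> 0 \<le> c m" and l: "0 < l"
  shows "fragment_sum c l \<le> c l + 4 * rel_growth l * (\<Sum>m\<in>{1..<l}. c m / growth m)"
proof -
  let ?A = "\<Sum>m\<in>{1..<l}. c m / growth (Suc m)"
  let ?B = "\<Sum>m\<in>{1..<l}. c m / growth m"
  have pos: "0 < growth m" if "0 < m" for m
    using growth_ge_1[OF that] by simp
  have AB: "?A \<le> ?B"
    using c pos growth_step by (intro sum_mono divide_left_mono) (auto intro!: mult_pos_pos)
  have A: "0 \<le> ?A" using c pos by (intro sum_nonneg divide_nonneg_pos) auto
  show ?thesis
  proof (cases "l \<in> D")
    case True
    then show ?thesis using A AB rel_growth_pos[OF l] by (simp add: fragment_sum_dead)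
  next
    case False
    then have l2: "2 \<le> real l" using alive_ge_2[of l] l by simp
    have "2 / (real l - 1) * (growth l * ?A) \<le> 4 / real l * (growth l * ?B)"
    proof (rule mult_mono)
      show "2 / (real l - 1) \<le> 4 / real l" using l2 by (simp add: field_simps)
      show "growth l * ?A \<le> growth l * ?B" using AB pos[OF l] by simp
    qed (use l2 A pos[OF l] in auto)
    then show ?thesis using False by (simp add: fragment_sum_def rel_growth_def)
  qed
qed

definition mean_ones :: "nat \<Rightarrow> real" where
  "mean_ones = fragment_sum (\<lambda>m. of_bool (m = 1))"

definition mean_count :: "nat \<Rightarrow> real" where
  "mean_count = fragment_sum (\<lambda>m. of_bool (m \<in> D))"

text \<open>
  After the first break the square of the number of ending sticks is \<open>(N + N')\<^sup>2\<close>, where \<open>N\<close> and \<open>N'\<close>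
  belong to the two pieces. The pieces evolve independently, so the mean of the mixed term \<open>2 * N * N'\<close>
  is the average below. It acts as the source in the recursion for the second moment.
\<close>

definition second_moment_source :: "nat \<Rightarrow> real" where
  "second_moment_source l =
     (if l \<in> D then 1
      else 2 / (real l - 1) * (\<Sum>x\<in>{1..<l}. mean_count x * mean_count (l - x)))"

definition second_moment :: "nat \<Rightarrow> real" where
  "second_moment = fragment_sum second_moment_source"

lemma mean_ones_ge:
  assumes "0 < l" "l \<notin> D"
  shows "2 * rel_growth l \<le> mean_ones l"
proof -
  have l: "2 \<le> l" using alive_ge_2 assms by blast
  have "(\<Sum>m\<in>{1..<l}. of_bool (m = 1) / growth (Suc m)) = (\<Sum>m\<in>{1}. 1 / growth (Suc m))"
    using l by (intro sum.mono_neutral_cong_right) auto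
  also have "\<dots> = 1" using one_in by (simp add: growth_Suc growth_1)
  finally have "mean_ones l = 2 / (real l - 1) * growth l"
    using assms l by (simp add: mean_ones_def fragment_sum_def)
  moreover have "2 / real l * growth l \<le> 2 / (real l - 1) * growth l"
    using l growth_ge_1[of l] by (intro mult_right_mono divide_left_mono) auto
  ultimately show ?thesis by (simp add: rel_growth_def)
qed

lemma mean_count_nonneg: "0 < l \<Longrightarrow> 0 \<le> mean_count l"
  unfolding mean_count_def by (rule fragment_sum_nonneg) auto

text \<open>
  The number of ending sticks is the sum over the dead lengths \<open>m\<close> of contributions of order
  \<open>rel_growth l / growth m\<close>, and these are summable. A single dead stick, with count \<open>1\<close>, fits the bound
  because \<open>rel_growth\<close> is bounded below.
\<close>

lemma mean_count_le:
  obtains C where "0 < C" "\<And>l. 0 < l \<Longrightarrow> mean_count l \<le> C * rel_growth l"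
proof -
  obtain C0 where C0: "0 < C0"
    "\<And>m l. 0 < m \<Longrightarrow> m \<le> l \<Longrightarrow> rel_growth m \<le> C0 * rel_growth l"
    using rel_growth_quasi_mono by blast
  obtain C1 where C1: "0 < C1" "\<And>l. (\<Sum>m\<in>{1..<l}. 1 / growth m) \<le> C1"
    using sum_inverse_growth_le by blast
  show thesis
  proof
    show "0 < C0 + 4 * C1" using C0 C1 by simp
    fix l :: nat
    assume l: "0 < l"
    have "(\<Sum>m\<in>{1..<l}. of_bool (m \<in> D) / growth m) \<le> (\<Sum>m\<in>{1..<l}. 1 / growth m)"
      using order_trans[OF zero_le_one growth_ge_1] by (intro sum_mono divide_right_mono) auto
    also have "\<dots> \<le> C1" by (rule C1)
    finally have "4 * rel_growth l * (\<Sum>m\<in>{1..<l}. of_bool (m \<in> D) / growth m)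
        \<le> 4 * rel_growth l * C1"
      using rel_growth_pos[OF l] by (intro mult_left_mono) auto
    moreover have "mean_count l
        \<le> of_bool (l \<in> D) + 4 * rel_growth l * (\<Sum>m\<in>{1..<l}. of_bool (m \<in> D) / growth m)"
      unfolding mean_count_def using l by (intro fragment_sum_le) auto
    moreover have "of_bool (l \<in> D) \<le> (1::real)" by simp
    moreover have "1 \<le> C0 * rel_growth l" using C0(2)[of 1 l] l by (simp add: rel_growth_1)
    moreover have "(C0 + 4 * C1) * rel_growth l = C0 * rel_growth l + 4 * rel_growth l * C1"
      by (simp add: algebra_simps)
    ultimately show "mean_count l \<le> (C0 + 4 * C1) * rel_growth l" by linarith
  qed
qed

lemma second_moment_source_nonneg: "0 < l \<Longrightarrow> 0 \<le> second_moment_source l"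
  unfolding second_moment_source_def
  by (auto simp: mean_count_nonneg simp del: times_divide_eq_left
      intro!: mult_nonneg_nonneg divide_nonneg_nonneg sum_nonneg)

lemma second_moment_source_le:
  obtains C where "0 < C" "\<And>l. 0 < l \<Longrightarrow> second_moment_source l \<le> C * (rel_growth l)\<^sup>2"
proof -
  obtain C0 where C0: "0 < C0"
    "\<And>m l. 0 < m \<Longrightarrow> m \<le> l \<Longrightarrow> rel_growth m \<le> C0 * rel_growth l"
    using rel_growth_quasi_mono by blast
  obtain C1 where C1: "0 < C1" "\<And>l. 0 < l \<Longrightarrow> mean_count l \<le> C1 * rel_growth l"
    using mean_count_le by blast
  show thesis
  proof
    show "0 < C0\<^sup>2 + 2 * (C1 * C0)\<^sup>2" using C0 by (intro add_pos_nonneg) auto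
    fix l :: nat
    assume l: "0 < l"
    let ?q = "rel_growth l"
    have q: "0 < ?q" using rel_growth_pos[OF l] .
    show "second_moment_source l \<le> (C0\<^sup>2 + 2 * (C1 * C0)\<^sup>2) * ?q\<^sup>2"
    proof (cases "l \<in> D")
      case True
      have "1 \<le> C0 * ?q" using C0(2)[of 1 l] l by (simp add: rel_growth_1)
      then have "1 \<le> (C0 * ?q)\<^sup>2" by (rule one_le_power)
      moreover have "0 \<le> 2 * (C1 * C0)\<^sup>2 * ?q\<^sup>2" by simp
      moreover have "(C0\<^sup>2 + 2 * (C1 * C0)\<^sup>2) * ?q\<^sup>2 = (C0 * ?q)\<^sup>2 + 2 * (C1 * C0)\<^sup>2 * ?q\<^sup>2"
        by (simp add: algebra_simps power_mult_distrib)
      moreover have "second_moment_source l = 1" using True by (simp add: second_moment_source_def)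
      ultimately show ?thesis by linarith
    next
      case False
      then have l2: "2 \<le> l" using alive_ge_2[of l] l by simp
      have M: "mean_count x \<le> C1 * C0 * ?q" if "0 < x" "x \<le> l" for x
      proof -
        have "mean_count x \<le> C1 * rel_growth x" using C1(2) that by simp
        also have "\<dots> \<le> C1 * (C0 * ?q)" using C0(2)[of x l] C1(1) that by simp
        finally show ?thesis by (simp add: mult.assoc)
      qed
      have "(\<Sum>x\<in>{1..<l}. mean_count x * mean_count (l - x))
          \<le> real (card {1..<l}) * ((C1 * C0 * ?q) * (C1 * C0 * ?q))"
        using M mean_count_nonneg C0(1) C1(1) q by (intro sum_bounded_above mult_mono) auto
      then have "2 / (real l - 1) * (\<Sum>x\<in>{1..<l}. mean_count x * mean_count (l - x))
          \<le> 2 / (real l - 1) * (real (card {1..<l}) * ((C1 * C0 * ?q) * (C1 * C0 * ?q)))"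
        using l2 by (intro mult_left_mono) auto
      also have "\<dots> = 2 * (C1 * C0)\<^sup>2 * ?q\<^sup>2"
        using l2 by (simp add: of_nat_diff power2_eq_square)
      also have "\<dots> \<le> (C0\<^sup>2 + 2 * (C1 * C0)\<^sup>2) * ?q\<^sup>2"
        by (intro mult_right_mono) auto
      finally show ?thesis using False by (simp add: second_moment_source_def)
    qed
  qed
qed

text \<open>
  A source of size \<open>(rel_growth m)\<^sup>2\<close> at \<open>m\<close> contributes at most a multiple of
  \<open>rel_growth l * (rel_growth m)\<^sup>2 / growth m = rel_growth l * rel_growth m / m\<close>, and the sum of these over
  \<open>m < l\<close> is of order \<open>(rel_growth l)\<^sup>2\<close>.
\<close>

lemma second_moment_le:
  obtains C where "0 < C" "\<And>l. 0 < l \<Longrightarrow> second_moment l \<le> C * (rel_growth l)\<^sup>2"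
proof -
  obtain C2 where C2: "0 < C2" "\<And>l. 0 < l \<Longrightarrow> second_moment_source l \<le> C2 * (rel_growth l)\<^sup>2"
    using second_moment_source_le by blast
  obtain C3 where C3: "0 < C3"
    "\<And>l. 0 < l \<Longrightarrow> (\<Sum>m\<in>{1..<l}. rel_growth m / real m) \<le> C3 * rel_growth l"
    using sum_rel_growth_div_le by blast
  show thesis
  proof
    show "0 < C2 + 4 * C2 * C3" using C2 C3 by (simp add: add_pos_pos)
    fix l :: nat
    assume l: "0 < l"
    let ?q = "rel_growth l"
    have "(\<Sum>m\<in>{1..<l}. second_moment_source m / growth m)
        \<le> (\<Sum>m\<in>{1..<l}. C2 * (rel_growth m / real m))"
    proof (rule sum_mono)
      fix m
      assume "m \<in> {1..<l}"
      then have m: "0 < m" by simp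
      then have p: "growth m = real m * rel_growth m" by (simp add: rel_growth_def)
      have "second_moment_source m / growth m \<le> C2 * (rel_growth m)\<^sup>2 / growth m"
        using C2(2)[OF m] growth_ge_1[OF m] by (intro divide_right_mono) auto
      also have "\<dots> = C2 * (rel_growth m / real m)"
        using rel_growth_pos[OF m] m by (simp add: p power2_eq_square)
      finally show "second_moment_source m / growth m \<le> C2 * (rel_growth m / real m)" .
    qed
    also have "\<dots> \<le> C2 * (C3 * ?q)"
      unfolding sum_distrib_left[symmetric] using C2(1) C3(2)[OF l] by (intro mult_left_mono) auto
    finally have "4 * ?q * (\<Sum>m\<in>{1..<l}. second_moment_source m / growth m)
        \<le> 4 * ?q * (C2 * (C3 * ?q))"
      using rel_growth_pos[OF l] by (intro mult_left_mono) auto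
    moreover have "second_moment l
        \<le> second_moment_source l + 4 * ?q * (\<Sum>m\<in>{1..<l}. second_moment_source m / growth m)"
      unfolding second_moment_def using second_moment_source_nonneg l by (rule fragment_sum_le)
    moreover note C2(2)[OF l]
    ultimately show "second_moment l \<le> (C2 + 4 * C2 * C3) * ?q\<^sup>2"
      by (simp add: algebra_simps power2_eq_square)
  qed
qed


section \<open>Moments of the numbers of ending sticks\<close>

lemma finite_break_stick:
  assumes "0 < l"
  shows "finite (set_pmf (break_stick D l))"
proof (cases "l \<in> D")
  case False
  then have "{1..l - 1} \<noteq> {}" using alive_ge_2[OF _ assms] by simp
  then show ?thesis using False by (simp add: break_stick_def)
qed (simp add: break_stick_def)

lemma finite_break_level:
  "\<forall>l\<in>set ls. 0 < l \<Longrightarrow> finite (set_pmf (break_level D ls))"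
  by (induction ls) (simp_all add: finite_break_stick)

lemma after_levels_pos:
  "0 < l \<Longrightarrow> xs \<in> set_pmf (after_levels D k (replicate r l)) \<Longrightarrow> \<forall>x\<in>set xs. 0 < x"
  using after_levels_support[OF one_in] by blast

lemma finite_after_levels:
  "0 < l \<Longrightarrow> finite (set_pmf (after_levels D k (replicate r l)))"
proof (induction k)
  case (Suc k)
  then show ?case using after_levels_pos by (auto intro!: finite_break_level)
qed simp

lemma expectation_bind_finite:
  fixes h :: "'b \<Rightarrow> real"
  assumes "finite (set_pmf p)" "\<And>x. x \<in> set_pmf p \<Longrightarrow> finite (set_pmf (f x))"
  shows "measure_pmf.expectation (bind_pmf p f) h =
    measure_pmf.expectation p (\<lambda>x. measure_pmf.expectation (f x) h)"
  using assms
  by (subst pmf_expectation_bind[of "set_pmf p"])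
     (auto simp: integral_measure_pmf[of "set_pmf p"])

lemma expectation_break_stick:
  assumes "0 < l" "l \<notin> D"
  shows "measure_pmf.expectation (break_stick D l) f =
    (\<Sum>x\<in>{1..<l}. f [x, l - x]) / (real l - 1)"
proof -
  have l: "2 \<le> l" using alive_ge_2 assms by blast
  then have "{1..l - 1} = {1..<l}" "{1..<l} \<noteq> {}" by auto
  then show ?thesis using assms l
    by (simp add: break_stick_def integral_pmf_of_set of_nat_diff)
qed

lemma expectation_break_level_Cons:
  fixes h :: "nat list \<Rightarrow> real"
  assumes "\<forall>x\<in>set (l # ls). 0 < x"
  shows "measure_pmf.expectation (break_level D (l # ls)) h =
    measure_pmf.expectation (break_stick D l)
      (\<lambda>xs. measure_pmf.expectation (break_level D ls) (\<lambda>ys. h (xs @ ys)))"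
  using assms finite_break_stick[of l] finite_break_level[of ls]
  by (simp add: expectation_bind_finite)

text \<open>
  A break replaces \<open>g l\<close> by a quantity with the same mean, so the sum of \<open>g\<close> over the sticks is a
  martingale.
\<close>

definition harmonic :: "(nat \<Rightarrow> real) \<Rightarrow> bool" where
  "harmonic g \<longleftrightarrow>
     (\<forall>l. 0 < l \<longrightarrow> l \<notin> D \<longrightarrow> g l = 2 / (real l - 1) * (\<Sum>x\<in>{1..<l}. g x))"

lemma harmonic_fragment_sum:
  assumes "\<And>l. 0 < l \<Longrightarrow> l \<notin> D \<Longrightarrow> c l = 0"
  shows "harmonic (fragment_sum c)"
  unfolding harmonic_def
proof (intro allI impI)
  fix l
  assume l: "0 < l" "l \<notin> D"
  show "fragment_sum c l = 2 / (real l - 1) * (\<Sum>x\<in>{1..<l}. fragment_sum c x)"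
    using fragment_sum_alive[OF l, of c] assms[OF l] by simp
qed

lemma harmonic_mean_ones: "harmonic mean_ones"
  unfolding mean_ones_def using one_in by (intro harmonic_fragment_sum) auto

lemma harmonic_mean_count: "harmonic mean_count"
  unfolding mean_count_def by (intro harmonic_fragment_sum) auto

lemma expectation_break_stick_sum:
  assumes "harmonic g" "0 < l"
  shows "measure_pmf.expectation (break_stick D l) (\<lambda>xs. sum_list (map g xs)) = g l"
proof (cases "l \<in> D")
  case True
  then show ?thesis by (simp add: break_stick_def)
next
  case False
  have "measure_pmf.expectation (break_stick D l) (\<lambda>xs. sum_list (map g xs)) =
      (\<Sum>x\<in>{1..<l}. g x + g (l - x)) / (real l - 1)"
    using expectation_break_stick[OF assms(2) False] by simp
  also have "\<dots> = 2 / (real l - 1) * (\<Sum>x\<in>{1..<l}. g x)"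
    by (simp add: sum.distrib sum_reflect del: One_nat_def)
  finally show ?thesis using assms False unfolding harmonic_def by metis
qed

lemma expectation_break_level_sum:
  assumes "harmonic g" "\<forall>l\<in>set ls. 0 < l"
  shows "measure_pmf.expectation (break_level D ls) (\<lambda>xs. sum_list (map g xs)) =
    sum_list (map g ls)"
  using assms(2)
proof (induction ls)
  case (Cons l ls)
  have int: "integrable (break_level D ls) f" "integrable (break_stick D l) f"
    for f :: "nat list \<Rightarrow> real"
    using Cons.prems by (auto intro!: integrable_measure_pmf_finite finite_break_level finite_break_stick)
  show ?case using Cons int expectation_break_stick_sum[OF assms(1), of l]
    by (simp add: expectation_break_level_Cons del: break_level.simps)
qed simp

text \<open>
  The conditional second moment of the final number of sticks, given the present sticks \<open>xs\<close>: the square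
  of the conditional mean plus the variances of the independent contributions. It is therefore a
  martingale, and it equals the square of the number of sticks once all of them are dead.
\<close>

definition square_plus_variance :: "nat list \<Rightarrow> real" where
  "square_plus_variance xs = (sum_list (map mean_count xs))\<^sup>2 +
     sum_list (map (\<lambda>x. second_moment x - (mean_count x)\<^sup>2) xs)"

lemma square_plus_variance_append:
  "square_plus_variance (xs @ ys) = square_plus_variance xs + square_plus_variance ys +
     2 * (sum_list (map mean_count xs) * sum_list (map mean_count ys))"
  by (simp add: square_plus_variance_def power2_sum algebra_simps)

lemma square_plus_variance_single: "square_plus_variance [l] = second_moment l"
  by (simp add: square_plus_variance_def)

lemma expectation_break_stick_square:
  assumes "0 < l"
  shows "measure_pmf.expectation (break_stick D l) square_plus_variance = second_moment l"
proof (cases "l \<in> D")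
  case True
  then show ?thesis by (simp add: break_stick_def square_plus_variance_single)
next
  case False
  have "square_plus_variance [x, y] =
      second_moment x + second_moment y + 2 * (mean_count x * mean_count y)" for x y
    by (simp add: square_plus_variance_def power2_sum algebra_simps)
  then have "measure_pmf.expectation (break_stick D l) square_plus_variance =
      (\<Sum>x\<in>{1..<l}. second_moment x + second_moment (l - x) +
         2 * (mean_count x * mean_count (l - x))) / (real l - 1)"
    using expectation_break_stick[OF assms False, of square_plus_variance] by simp
  also have "\<dots> = second_moment_source l + 2 / (real l - 1) * (\<Sum>x\<in>{1..<l}. second_moment x)"
    using False
    by (simp add: sum.distrib sum_reflect second_moment_source_def sum_distrib_left[symmetric]
        add_divide_distrib del: One_nat_def)
  also have "\<dots> = second_moment l"
    using fragment_sum_alive[OF assms False, of second_moment_source]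
    by (simp add: second_moment_def)
  finally show ?thesis .
qed

text \<open>
  The mixed term of \<open>square_plus_variance_append\<close> factorises since different sticks break
  independently, and each of its factors is preserved in mean because \<open>mean_count\<close> is harmonic.
\<close>

lemma expectation_break_level_square:
  assumes "\<forall>l\<in>set ls. 0 < l"
  shows "measure_pmf.expectation (break_level D ls) square_plus_variance = square_plus_variance ls"
  using assms
proof (induction ls)
  case Nil
  then show ?case by simp
next
  case (Cons l ls)
  let ?M = "\<lambda>xs. sum_list (map mean_count xs)"
  have int: "integrable (break_level D ls) f" "integrable (break_stick D l) f"
    for f :: "nat list \<Rightarrow> real"
    using Cons.prems by (auto intro!: integrable_measure_pmf_finite finite_break_level finite_break_stick)
  have "measure_pmf.expectation (break_level D ls) ?M = ?M ls"
    using Cons.prems by (intro expectation_break_level_sum harmonic_mean_count) auto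
  moreover have "measure_pmf.expectation (break_stick D l) ?M = mean_count l"
    using Cons.prems by (intro expectation_break_stick_sum harmonic_mean_count) auto
  moreover have "measure_pmf.expectation (break_level D ls) square_plus_variance
      = square_plus_variance ls"
    using Cons by simp
  moreover have "measure_pmf.expectation (break_stick D l) square_plus_variance
      = square_plus_variance [l]"
    using Cons.prems by (simp add: expectation_break_stick_square square_plus_variance_single)
  ultimately have "measure_pmf.expectation (break_level D (l # ls)) square_plus_variance
      = square_plus_variance [l] + square_plus_variance ls + 2 * (mean_count l * ?M ls)"
    using int
    by (simp add: expectation_break_level_Cons[OF Cons.prems] square_plus_variance_append
        del: break_level.simps)
  then show ?case using square_plus_variance_append[of "[l]" ls] by simp
qed

lemma expectation_after_levels:
  fixes f :: "nat list \<Rightarrow> real"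
  assumes "\<And>ls. \<forall>l\<in>set ls. 0 < l \<Longrightarrow> measure_pmf.expectation (break_level D ls) f = f ls"
    and "0 < l"
  shows "measure_pmf.expectation (after_levels D k (replicate r l)) f = f (replicate r l)"
proof (induction k)
  case (Suc k)
  have "measure_pmf.expectation (after_levels D (Suc k) (replicate r l)) f =
      measure_pmf.expectation (after_levels D k (replicate r l))
        (\<lambda>ls. measure_pmf.expectation (break_level D ls) f)"
    using assms(2) after_levels_pos
    by (auto intro!: expectation_bind_finite finite_after_levels finite_break_level)
  also have "\<dots> = measure_pmf.expectation (after_levels D k (replicate r l)) f"
    using assms after_levels_pos by (intro integral_cong_AE) (auto simp: AE_measure_pmf_iff)
  finally show ?case using Suc by simp
qed simp

lemma expectation_ending_sticks:
  fixes f g :: "nat list \<Rightarrow> real"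
  assumes "\<And>ls. \<forall>l\<in>set ls. 0 < l \<Longrightarrow> measure_pmf.expectation (break_level D ls) f = f ls"
    and "\<And>xs. set xs \<subseteq> D \<Longrightarrow> g xs = f xs" and l: "0 < l"
  shows "measure_pmf.expectation (ending_sticks D l r) g = f (replicate r l)"
proof -
  have "measure_pmf.expectation (ending_sticks D l r) g =
      measure_pmf.expectation (ending_sticks D l r) f"
    using assms(2) after_levels_dead[OF one_in l order_refl]
    by (intro integral_cong_AE) (auto simp: AE_measure_pmf_iff ending_sticks_def)
  then show ?thesis
    using expectation_after_levels[OF assms(1) l] by (simp add: ending_sticks_def)
qed

lemma expectation_number_of_ones:
  assumes "0 < l"
  shows "measure_pmf.expectation (ending_sticks D l r) (\<lambda>xs. real (count_list xs 1)) =
    real r * mean_ones l"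
proof -
  have "real (count_list xs 1) = sum_list (map mean_ones xs)" if "set xs \<subseteq> D" for xs
    using that by (induction xs) (auto simp: mean_ones_def fragment_sum_dead)
  then show ?thesis
    by (subst expectation_ending_sticks[where f = "\<lambda>xs. sum_list (map mean_ones xs)"])
       (use assms in \<open>auto simp: expectation_break_level_sum harmonic_mean_ones sum_list_replicate\<close>)
qed

lemma expectation_number_squared:
  assumes "0 < l"
  shows "measure_pmf.expectation (ending_sticks D l r) (\<lambda>xs. (real (length xs))\<^sup>2) =
    (real r * mean_count l)\<^sup>2 + real r * (second_moment l - (mean_count l)\<^sup>2)"
proof -
  have "(real (length xs))\<^sup>2 = square_plus_variance xs" if "set xs \<subseteq> D" for xs
  proof -
    have "sum_list (map mean_count xs) = real (length xs)"
      using that by (induction xs) (auto simp: mean_count_def fragment_sum_dead)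
    moreover have "sum_list (map (\<lambda>x. second_moment x - (mean_count x)\<^sup>2) xs) = 0"
      using that
      by (induction xs)
         (auto simp: mean_count_def second_moment_def second_moment_source_def fragment_sum_dead)
    ultimately show ?thesis by (simp add: square_plus_variance_def)
  qed
  then have "measure_pmf.expectation (ending_sticks D l r) (\<lambda>xs. (real (length xs))\<^sup>2) =
      square_plus_variance (replicate r l)"
    using assms expectation_break_level_square by (intro expectation_ending_sticks) auto
  then show ?thesis by (simp add: square_plus_variance_def sum_list_replicate)
qed

text \<open>
  For every \<open>\<theta> > 0\<close> one has \<open>N1 / N \<ge> 2 * \<theta> * N1 - \<theta>\<^sup>2 * N\<^sup>2\<close>, because \<open>N1 \<le> N\<close> and
  \<open>(1 - \<theta> * N)\<^sup>2 \<ge> 0\<close>. This bounds the mean of the quotient by moments that are known up to constants: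
  \<open>E N1\<close> is at least \<open>2 * r * q\<close> and \<open>E (N\<^sup>2)\<close> is at most \<open>C * (r * q)\<^sup>2\<close>, with \<open>q = rel_growth l\<close>.
\<close>

lemma proportion_of_ones_ge:
  obtains c where "0 < c"
    "\<And>l r. 0 < l \<Longrightarrow> l \<notin> D \<Longrightarrow> 0 < r \<Longrightarrow>
       c \<le> measure_pmf.expectation (ending_sticks D l r)
             (\<lambda>xs. real (count_list xs 1) / real (length xs))"
proof -
  obtain C1 where C1: "0 < C1" "\<And>l. 0 < l \<Longrightarrow> mean_count l \<le> C1 * rel_growth l"
    using mean_count_le by blast
  obtain C2 where C2: "0 < C2" "\<And>l. 0 < l \<Longrightarrow> second_moment l \<le> C2 * (rel_growth l)\<^sup>2"
    using second_moment_le by blast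
  define C where "C = C1\<^sup>2 + C2"
  have C: "0 < C" using C1 C2 by (simp add: C_def add_pos_pos)
  show thesis
  proof
    show "0 < 4 / C" using C by simp
    fix l r :: nat
    assume l: "0 < l" "l \<notin> D" and r: "0 < r"
    let ?E = "measure_pmf.expectation (ending_sticks D l r)"
    let ?N1 = "\<lambda>xs. real (count_list xs 1)"
    let ?N = "\<lambda>xs. real (length xs)"
    define q where "q = rel_growth l"
    have q: "0 < q" using rel_growth_pos l by (simp add: q_def)
    \<comment> \<open>The maximiser of the resulting lower bound \<open>4 * \<theta> * r * q - C * (\<theta> * r * q)\<^sup>2\<close>.\<close>
    define \<theta> where "\<theta> = 2 / (C * real r * q)"
    have \<theta>: "0 < \<theta>" using C r q by (simp add: \<theta>_def)
    have int: "integrable (ending_sticks D l r) f" for f :: "nat list \<Rightarrow> real"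
      unfolding ending_sticks_def using finite_after_levels[OF l(1)]
      by (rule integrable_measure_pmf_finite)
    have ptwise: "2 * \<theta> * ?N1 xs - \<theta>\<^sup>2 * (?N xs)\<^sup>2 \<le> ?N1 xs / ?N xs" for xs
    proof (cases "xs = []")
      case False
      then have N: "0 < ?N xs" by simp
      have N1: "?N1 xs \<le> ?N xs" by (simp add: count_le_length)
      have "0 \<le> (1 - \<theta> * ?N xs)\<^sup>2 / ?N xs" by simp
      also have "\<dots> = 1 / ?N xs - (2 * \<theta> - \<theta>\<^sup>2 * ?N xs)"
        using N by (simp add: field_simps power2_eq_square)
      finally have "?N1 xs * (2 * \<theta> - \<theta>\<^sup>2 * ?N xs) \<le> ?N1 xs * (1 / ?N xs)"
        by (intro mult_left_mono) auto
      moreover have "\<theta>\<^sup>2 * ?N xs * ?N1 xs \<le> \<theta>\<^sup>2 * ?N xs * ?N xs"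
        using N1 by (intro mult_left_mono) auto
      ultimately show ?thesis by (simp add: algebra_simps power2_eq_square)
    qed simp
    have "4 / C = 2 * \<theta> * (real r * (2 * q)) - \<theta>\<^sup>2 * ((real r)\<^sup>2 * (C * q\<^sup>2))"
      using C q r by (simp add: \<theta>_def field_simps power2_eq_square)
    also have "\<dots> \<le> 2 * \<theta> * ?E ?N1 - \<theta>\<^sup>2 * ?E (\<lambda>xs. (?N xs)\<^sup>2)"
    proof (intro diff_mono mult_left_mono)
      show "real r * (2 * q) \<le> ?E ?N1"
        using expectation_number_of_ones[OF l(1), of r] mean_ones_ge[OF l] by (simp add: q_def mult_left_mono)
      have M: "(mean_count l)\<^sup>2 \<le> (C1 * q)\<^sup>2"
        using C1(2)[OF l(1)] mean_count_nonneg[OF l(1)] by (simp add: q_def power_mono)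
      have "?E (\<lambda>xs. (?N xs)\<^sup>2) \<le> (real r)\<^sup>2 * (mean_count l)\<^sup>2 + real r * second_moment l"
        using expectation_number_squared[OF l(1), of r]
        by (simp add: power_mult_distrib right_diff_distrib)
      also have "\<dots> \<le> (real r)\<^sup>2 * (C1 * q)\<^sup>2 + (real r)\<^sup>2 * (C2 * q\<^sup>2)"
      proof (intro add_mono mult_left_mono M)
        have "real r * second_moment l \<le> real r * (C2 * q\<^sup>2)"
          using C2(2)[OF l(1)] by (simp add: q_def mult_left_mono)
        also have "\<dots> \<le> (real r)\<^sup>2 * (C2 * q\<^sup>2)"
          using r C2(1) self_le_power[of "real r" 2] by (intro mult_right_mono) auto
        finally show "real r * second_moment l \<le> (real r)\<^sup>2 * (C2 * q\<^sup>2)" .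
      qed simp
      finally show "?E (\<lambda>xs. (?N xs)\<^sup>2) \<le> (real r)\<^sup>2 * (C * q\<^sup>2)"
        by (simp add: C_def algebra_simps power_mult_distrib)
    qed (use \<theta> in auto)
    also have "\<dots> = ?E (\<lambda>xs. 2 * \<theta> * ?N1 xs - \<theta>\<^sup>2 * (?N xs)\<^sup>2)"
      using int by simp
    also have "\<dots> \<le> ?E (\<lambda>xs. ?N1 xs / ?N xs)"
      by (intro integral_mono int ptwise)
    finally show "4 / C \<le> ?E (\<lambda>xs. ?N1 xs / ?N xs)" .
  qed
qed

lemma mantissa_proportion_0_ge:
  "real (count_list xs 1) / real (length xs) \<le> mantissa_proportion B 0 xs"
proof -
  have "count_list xs 1 \<le> length (filter (\<lambda>x. log_mantissa B (real x) \<le> 0) xs)"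
    by (induction xs) (auto simp: log_mantissa_def)
  then show ?thesis unfolding mantissa_proportion_def by (intro divide_right_mono) auto
qed

lemma limit_at_0_pos:
  assumes conv: "mantissas_converge B D L R F"
    and L: "\<And>j. 0 < L j \<and> L j \<notin> D" and R: "filterlim R at_top sequentially"
  shows "0 < F 0"
proof -
  obtain c where c: "0 < c" "\<And>l r. 0 < l \<Longrightarrow> l \<notin> D \<Longrightarrow> 0 < r \<Longrightarrow>
       c \<le> measure_pmf.expectation (ending_sticks D l r)
             (\<lambda>xs. real (count_list xs 1) / real (length xs))"
    using proportion_of_ones_ge by blast
  let ?E = "\<lambda>j. measure_pmf.expectation (ending_sticks D (L j) (R j)) (mantissa_proportion B 0)"
  have lim: "?E \<longlonglongrightarrow> F 0"
    using conv unfolding mantissas_converge_def by simp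
  have "eventually (\<lambda>j. 0 < R j) sequentially"
    using R by (rule eventually_compose_filterlim[OF eventually_gt_at_top])
  then have "eventually (\<lambda>j. c \<le> ?E j) sequentially"
  proof eventually_elim
    case (elim j)
    have int: "integrable (ending_sticks D (L j) (R j)) f" for f :: "nat list \<Rightarrow> real"
      unfolding ending_sticks_def using finite_after_levels L
      by (intro integrable_measure_pmf_finite) auto
    have "c \<le> measure_pmf.expectation (ending_sticks D (L j) (R j))
             (\<lambda>xs. real (count_list xs 1) / real (length xs))"
      using c(2) L elim by blast
    also have "\<dots> \<le> ?E j" by (intro integral_mono int mantissa_proportion_0_ge)
    finally show ?case .
  qed
  then have "c \<le> F 0"
    using lim by (intro tendsto_lowerbound[OF lim]) auto
  with c(1) show ?thesis by simp
qed

end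


section \<open>Residue classes as stopping sets\<close>

lemma mod_mem_of_stopping_set:
  assumes "S \<subseteq> {0..n - 1}" "2 \<le> n" "2 \<le> m" "m \<in> stopping_set n S"
  shows "m mod n \<in> S"
proof -
  obtain q :: int and r where r: "r \<in> S" "int m = q * int n + int r"
    using assms by (auto simp: stopping_set_def)
  then have "r < n" using assms by fastforce
  have "int (m mod n) = (q * int n + int r) mod int n" by (simp add: zmod_int r)
  also have "\<dots> = int r" using \<open>r < n\<close> by simp
  finally show ?thesis using r by simp
qed

lemma inj_on_mod_window: "inj_on (\<lambda>k. k mod n) {l..<l + n}" for n :: nat
proof (rule linorder_inj_onI)
  fix x y
  assume "x < y" "x \<in> {l..<l + n}" "y \<in> {l..<l + n}"
  then have "0 < y - x" "y - x < n" by auto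
  then have "\<not> n dvd y - x" by (auto dest: dvd_imp_le)
  then show "x mod n \<noteq> y mod n" using \<open>x < y\<close> mod_eq_dvd_iff_nat[of x y n] by auto
qed auto

text \<open>
  Reduction modulo \<open>n\<close> maps the dead lengths of a window injectively into \<open>S\<close>.
\<close>

lemma thin_stopping_set_stopping_set:
  assumes "2 \<le> n" "S \<subseteq> {0..n - 1}" "real (card S) < real n / 2"
  shows "thin_stopping_set (stopping_set n S) n"
proof
  show "1 \<in> stopping_set n S" by (simp add: stopping_set_def)
  fix l :: nat
  assume "2 \<le> l"
  then have "card (stopping_set n S \<inter> {l..<l + n}) \<le> card S"
    using assms(1,2) mod_mem_of_stopping_set[OF assms(2,1)] finite_subset[OF assms(2)]
      inj_on_subset[OF inj_on_mod_window, of "stopping_set n S \<inter> {l..<l + n}" l n]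
    by (intro card_inj_on_le[of "\<lambda>k. k mod n"]) auto
  then show "2 * card (stopping_set n S \<inter> {l..<l + n}) < n" using assms(3) by linarith
qed

text \<open>All mass lies in \<open>[0,1]\<close>, and continuity excludes an atom at \<open>0\<close>.\<close>

lemma cdf_continuous_distribution_on_unit_0:
  assumes "continuous_distribution_on_unit \<mu>"
  shows "cdf \<mu> 0 = 0"
proof -
  interpret real_distribution \<mu>
    using assms by (simp add: continuous_distribution_on_unit_def)
  have "isCont (cdf \<mu>) 0"
    using assms by (simp add: continuous_distribution_on_unit_def continuous_on_eq_continuous_at)
  then have 0: "measure \<mu> {0} = 0" by (simp add: isCont_cdf)
  have "measure \<mu> ({..<0} \<union> {0..1}) = measure \<mu> {..<0} + measure \<mu> {0..1}"
    by (intro finite_measure_Union) auto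
  moreover have "measure \<mu> ({..<0} \<union> {0..1}) \<le> 1" by (rule prob_le_1)
  ultimately have "measure \<mu> {..<0} = 0"
    using assms measure_nonneg[of \<mu> "{..<0}"]
    unfolding continuous_distribution_on_unit_def by linarith
  moreover have "measure \<mu> ({..<0} \<union> {0}) = measure \<mu> {..<0} + measure \<mu> {0}"
    by (intro finite_measure_Union) auto
  moreover have "{..<0} \<union> {0} = {..0::real}" by auto
  ultimately show ?thesis using 0 by (simp add: cdf_def)
qed

theorem theorem5p15:
  fixes n :: nat and S :: "nat set" and B :: real and L R :: "nat \<Rightarrow> nat"
  assumes "n \<ge> 2"
    and "S \<subseteq> {0..n - 1}"
    and "real (card S) < real n / 2"
    and "B > 1"
    and "\<And>j. 0 < L j \<and> L j \<notin> stopping_set n S"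
    and "filterlim L at_top sequentially"
    and "filterlim R at_top sequentially"
  shows "(\<nexists>\<mu>. continuous_distribution_on_unit \<mu> \<and>
                mantissas_converge B (stopping_set n S) L R (cdf \<mu>)) \<and>
         \<not> converges_to_strong_benford B (stopping_set n S) L R"
proof -
  interpret thin_stopping_set "stopping_set n S" n
    using assms(1-3) by (rule thin_stopping_set_stopping_set)
  show ?thesis
    using limit_at_0_pos[OF _ assms(5,7)] cdf_continuous_distribution_on_unit_0
    unfolding converges_to_strong_benford_def by fastforce
qed

end
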